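(* Let $g>1$ be an integer, and let $f(X)\in\mathbb{Z}[X]$ be a polynomial of degree $\deg f\ge 3$ with a positive leading coefficient and no multiple roots in its splitting field. Put $u(n)=f(g^n)$ for $n\ge 1$. Let $\alpha>0$ be a real number for which $$ \left|\left\{\ell\le z:\ \ell \text{ is prime and } P^+(\ell-1)\ge \ell^{\alpha}\right\}\right|\gg \frac{z}{\log z} $$ for all sufficiently large $z$, where the implied constant depends only on $\alpha$. Then for $M\in\mathbb{Z}$, integers $N\ge1$ and $S\ge 1$, $$ \mathcal{Q}_u(M,N;S)\le\left(S^{3/(3+\alpha)}N^{(3-\alpha)/(3+\alpha)}+S^{1/2}N^{(3-\alpha)/(1+3\alpha)}\right)N^{o(1)} $$ as $N\to\infty$, where the function of $N$ implied by $o(1)$ depends only on $f$, $g$ and $\alpha$.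
   Context: $P^+(k)$ denotes the largest prime divisor of an integer $k\ge 2$. For $M,N,s\in\mathbb{Z}$ with $N\ge1$ and $s$ squarefree, $Q_u(M,N;s)$ denotes the number of integers $n\in[M+1,M+N]$ (with $n\ge 1$, where $u(n)$ is defined) for which $\mathbb{Q}(\sqrt{u(n)})=\mathbb{Q}(\sqrt{s})$. Put $$\mathcal{Q}_u(M,N;S)=\sum_{\substack{1\le s\le S\\ s\text{ squarefree}}}Q_u(M,N;s).$$ The notation $B\gg A$ means $|A|\le cB$ for some constant $c>0$ (the implied constant). *)

theory Defs
  imports
    "HOL-Algebra.Generated_Fields"
    "HOL-Algebra.Algebraic_Closure_Type"
    "HOL-Computational_Algebra.Computational_Algebra"
    "HOL-Analysis.Analysis"
begin

(* Largest prime divisor of k >= 2. The value 1 for k < 2 is a convention: it makes the prime 2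
   fail the condition P_plus (l - 1) >= l powr a for every a > 0. *)
definition P_plus :: "nat \<Rightarrow> nat" where
  "P_plus k = (if k \<ge> 2 then Max (prime_factors k) else 1)"

(* The field Q(sqrt a), as the subfield of the complex numbers generated by a square root of a.
   It does not depend on the choice of the root; Q(sqrt 0) = Q(sqrt 1) = Q. *)
definition Q_sqrt :: "int \<Rightarrow> complex set" where
  "Q_sqrt a = generate_field (ring_of_type_algebra :: complex ring) {csqrt (of_int a)}"

definition Q_count :: "(nat \<Rightarrow> int) \<Rightarrow> int \<Rightarrow> nat \<Rightarrow> int \<Rightarrow> nat" where
  "Q_count u M N s =
     card {n::nat. n \<ge> 1 \<and> int n \<in> {M + 1..M + int N} \<and> Q_sqrt (u n) = Q_sqrt s}"

definition Q_total :: "(nat \<Rightarrow> int) \<Rightarrow> int \<Rightarrow> nat \<Rightarrow> nat \<Rightarrow> nat" where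
  "Q_total u M N S = (\<Sum>s\<in>{s::int. 1 \<le> s \<and> s \<le> int S \<and> squarefree s}. Q_count u M N s)"

end

theory Submission
  imports Defs "HOL-Real_Asymp.Real_Asymp"
begin

text \<open>
  If \<open>u(n)\<close> and \<open>u(n + h)\<close> generate the same quadratic field, then \<open>u(n) u(n + h)\<close> is a
  perfect square, that is, \<open>F(x) = f(x) f(g^h x)\<close> is a square at \<open>x = g^n\<close>. For even \<open>h\<close> the
  leading coefficient of \<open>F\<close> is a square, so Runge's method applies and bounds \<open>x\<close> by a fixed power
  of the coefficients of \<open>F\<close>, which are of size \<open>g^O(h)\<close>; hence \<open>n \<le> C h\<close>. Therefore the \<open>n\<close> of given
  parity belonging to one field grow geometrically, there are only \<open>O(log N)\<close> of them in any window
  of length \<open>N\<close>, and the total count is at most \<open>min(N, O(S log N))\<close>. The hypothesis on shifted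
  primes forces \<open>\<alpha> < 1\<close>, and then this is below the first term of the claimed bound.
\<close>

section \<open>Length of integer polynomials, with value and root bounds\<close>

definition poly_len :: "int poly \<Rightarrow> int" where
  "poly_len p = sum_list (map abs (coeffs p))"

lemma poly_len_0 [simp]: "poly_len 0 = 0"
  by (simp add: poly_len_def)

lemma poly_len_pCons [simp]: "poly_len (pCons a p) = \<bar>a\<bar> + poly_len p"
  by (cases "a = 0 \<and> p = 0") (auto simp: poly_len_def cCons_def)

lemma poly_len_nonneg [simp]: "poly_len p \<ge> 0"
  by (induction p) auto

lemma poly_len_add: "poly_len (p + q) \<le> poly_len p + poly_len q"
proof (induction p arbitrary: q)
  case (pCons a p)
  obtain b r where q: "q = pCons b r" by (cases q)
  show ?case using pCons.IH[of r] abs_triangle_ineq[of a b] by (simp add: q)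
qed simp

lemma poly_len_smult: "poly_len (smult c p) = \<bar>c\<bar> * poly_len p"
  by (induction p) (auto simp: abs_mult algebra_simps)

lemma poly_len_diff: "poly_len (p - q) \<le> poly_len p + poly_len q"
  using poly_len_add[of p "- q"] poly_len_smult[of "-1" q] by simp

lemma poly_len_mult: "poly_len (p * q) \<le> poly_len p * poly_len q"
proof (induction p)
  case (pCons a p)
  have "poly_len (pCons a p * q) \<le> \<bar>a\<bar> * poly_len q + poly_len (p * q)"
    using poly_len_add[of "smult a q" "pCons 0 (p * q)"] by (simp add: poly_len_smult)
  with pCons.IH show ?case by (simp add: algebra_simps)
qed simp

lemma poly_len_monom [simp]: "poly_len (monom c n) = \<bar>c\<bar>"
  by (induction n) (auto simp: monom_0 monom_Suc)

lemma abs_coeff_le_poly_len: "\<bar>coeff p i\<bar> \<le> poly_len p"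
proof (induction p arbitrary: i)
  case (pCons a p)
  show ?case
  proof (cases i)
    case (Suc j)
    thus ?thesis using pCons.IH[of j] by simp
  qed simp
qed simp

lemma poly_len_pos: "p \<noteq> 0 \<Longrightarrow> poly_len p \<ge> 1"
  using abs_coeff_le_poly_len[of p "degree p"] leading_coeff_neq_0[of p] by linarith

lemma abs_poly_le_poly_len:
  assumes "x \<ge> 1" "degree p \<le> d"
  shows "\<bar>poly p x\<bar> \<le> poly_len p * x ^ d"
  using assms(2)
proof (induction p arbitrary: d)
  case (pCons a p)
  show ?case
  proof (cases "p = 0")
    case True
    have "\<bar>a\<bar> * 1 \<le> \<bar>a\<bar> * x ^ d"
      using assms(1) by (intro mult_left_mono) auto
    thus ?thesis using True by simp
  next
    case False
    then obtain e where e: "d = Suc e" "degree p \<le> e"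
      using pCons.prems by (cases d) auto
    have 1: "\<bar>poly p x\<bar> \<le> poly_len p * x ^ e" using pCons.IH e by blast
    have "\<bar>poly (pCons a p) x\<bar> \<le> \<bar>a\<bar> + x * \<bar>poly p x\<bar>"
      using assms(1) abs_triangle_ineq[of a "x * poly p x"] by (simp add: abs_mult)
    also have "\<dots> \<le> \<bar>a\<bar> * x ^ d + x * (poly_len p * x ^ e)"
    proof (intro add_mono mult_left_mono 1)
      have "\<bar>a\<bar> * 1 \<le> \<bar>a\<bar> * x ^ d"
        using assms(1) by (intro mult_left_mono) auto
      thus "\<bar>a\<bar> \<le> \<bar>a\<bar> * x ^ d" by simp
    qed (use assms in auto)
    finally show ?thesis by (simp add: e algebra_simps)
  qed
qed simp

lemma abs_poly_minus_top_le:
  assumes "x \<ge> 1" "degree p \<le> Suc d"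
  shows "\<bar>poly p x - coeff p (Suc d) * x ^ Suc d\<bar> \<le> (poly_len p + \<bar>coeff p (Suc d)\<bar>) * x ^ d"
proof -
  let ?q = "p - monom (coeff p (Suc d)) (Suc d)"
  have "degree ?q \<le> d"
  proof (rule degree_le, intro allI impI)
    fix i assume "d < i"
    thus "coeff ?q i = 0" using assms(2) by (cases "i = Suc d") (auto simp: coeff_eq_0)
  qed
  with assms(1) have "\<bar>poly ?q x\<bar> \<le> poly_len ?q * x ^ d" by (rule abs_poly_le_poly_len)
  also have "\<dots> \<le> (poly_len p + \<bar>coeff p (Suc d)\<bar>) * x ^ d"
    using assms(1) poly_len_diff[of p "monom (coeff p (Suc d)) (Suc d)"]
    by (intro mult_right_mono) auto
  finally show ?thesis by (simp add: poly_monom)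
qed

text \<open>A nonzero integer coefficient has absolute value at least 1, so the top term is at least
  \<open>x ^ Suc d\<close>; the remaining terms cost at most
  \<open>2 * poly_len p * x ^ d\<close>.\<close>

lemma abs_poly_ge:
  assumes "x \<ge> 1" "degree p \<le> Suc d" "coeff p (Suc d) \<noteq> 0"
  shows "\<bar>poly p x\<bar> \<ge> (x - 2 * poly_len p) * x ^ d"
proof -
  have "1 * x ^ Suc d \<le> \<bar>coeff p (Suc d)\<bar> * x ^ Suc d"
    using assms by (intro mult_right_mono) auto
  hence "x ^ Suc d \<le> \<bar>coeff p (Suc d) * x ^ Suc d\<bar>" using assms(1) by (simp add: abs_mult)
  moreover have "(poly_len p + \<bar>coeff p (Suc d)\<bar>) * x ^ d \<le> (2 * poly_len p) * x ^ d"
    using assms(1) abs_coeff_le_poly_len[of p "Suc d"] by (intro mult_right_mono) auto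
  ultimately have "\<bar>poly p x\<bar> \<ge> x ^ Suc d - 2 * poly_len p * x ^ d"
    using abs_poly_minus_top_le[OF assms(1,2)] by linarith
  thus ?thesis by (simp add: algebra_simps)
qed

text \<open>A Cauchy-type root bound: beyond \<open>2 * poly_len p\<close> the lower bound in
  \<open>abs_poly_ge\<close> is positive.\<close>

lemma poly_root_le_poly_len:
  assumes "p \<noteq> 0" "poly p x = 0"
  shows "x \<le> 2 * poly_len p"
proof (rule ccontr)
  assume "\<not> x \<le> 2 * poly_len p"
  with poly_len_pos[OF assms(1)] have x: "x > 2 * poly_len p" "x \<ge> 1" by auto
  show False
  proof (cases "degree p")
    case 0
    then show False using assms by (auto elim: degree_eq_zeroE)
  next
    case (Suc d)
    hence "(x - 2 * poly_len p) * x ^ d \<le> 0"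
      using abs_poly_ge[of x p d] x assms leading_coeff_neq_0[of p] by auto
    moreover have "(x - 2 * poly_len p) * x ^ d > 0" using x by simp
    ultimately show False by simp
  qed
qed

section \<open>Runge's method with explicit bounds\<close>

lemma poly_len_sqrt_remainder:
  assumes "D \<ge> 0" "D \<le> B" "poly_len P \<le> B" "poly_len F < B"
  shows "poly_len (smult (D ^ 2) F - P ^ 2) \<le> B ^ 3"
proof -
  have "poly_len (P ^ 2) \<le> poly_len P ^ 2"
    using poly_len_mult[of P P] by (simp add: power2_eq_square)
  also have "\<dots> \<le> B ^ 2" using assms by (intro power_mono) auto
  finally have "poly_len (smult (D ^ 2) F - P ^ 2) \<le> D ^ 2 * poly_len F + B ^ 2"
    using poly_len_diff[of "smult (D ^ 2) F" "P ^ 2"] by (simp add: poly_len_smult)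
  also have "D ^ 2 * poly_len F \<le> B ^ 2 * poly_len F"
    using assms by (intro mult_right_mono power_mono) auto
  also have "B ^ 2 * poly_len F + B ^ 2 = B ^ 2 * (poly_len F + 1)" by (simp add: algebra_simps)
  also have "\<dots> \<le> B ^ 2 * B" using assms by (intro mult_left_mono) auto
  finally show ?thesis by (simp add: power3_eq_cube power2_eq_square)
qed

text \<open>Explains the base 5 in the bounds below: one step of the square root construction
  replaces a bound \<open>B\<close> by at most \<open>4 * B ^ 3\<close>, which is at most
  \<open>B ^ 5\<close> once \<open>B \<ge> 2\<close>.\<close>

lemma four_cube_le_pow5:
  fixes c :: int
  assumes "c \<ge> 2"
  shows "4 * (c ^ (5 ^ k)) ^ 3 \<le> c ^ (5 ^ Suc k)"
proof -
  define B where "B = c ^ (5 ^ k)"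
  have "c \<le> B" unfolding B_def using assms by (intro self_le_power) auto
  hence "4 * B ^ 3 \<le> B ^ 2 * B ^ 3"
    using assms power_mono[of 2 B 2] by (intro mult_right_mono) auto
  also have "\<dots> = B ^ 5" by (simp flip: power_add)
  also have "\<dots> = c ^ (5 ^ k * 5)" unfolding B_def by (rule power_mult [symmetric])
  finally show ?thesis by (simp add: B_def mult.commute)
qed

text \<open>A denominator-free expansion of the square root of \<open>F\<close> at infinity:
  \<open>P / D\<close> approximates it, and each step cancels one more coefficient of the remainder.
  The square leading coefficient provides the start \<open>P = A x^d\<close>, \<open>D = 1\<close>.
  Writing \<open>2 * d \<le> i + k\<close> avoids truncated subtraction.\<close>

lemma poly_sqrt_approx:
  fixes F :: "int poly"
  assumes deg: "degree F \<le> 2 * d" and lead: "coeff F (2 * d) = A ^ 2" and A: "A > 0"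
    and k: "k \<le> d"
  shows "\<exists>P D. D \<ge> 1 \<and> coeff P d \<ge> 1 \<and> degree P \<le> d \<and>
    D \<le> (2 * poly_len F) ^ (5 ^ k) \<and> poly_len P \<le> (2 * poly_len F) ^ (5 ^ k) \<and>
    (\<forall>i. 2 * d \<le> i + k \<longrightarrow> coeff (smult (D ^ 2) F - P ^ 2) i = 0)"
  using k
proof (induction k)
  case 0
  have "A * 1 \<le> A ^ 2" using A by (simp add: power2_eq_square)
  moreover have "A ^ 2 \<le> poly_len F" using abs_coeff_le_poly_len[of F "2 * d"] lead by simp
  ultimately have "A \<le> 2 * poly_len F" "1 \<le> 2 * poly_len F" using A by auto
  moreover have "coeff (F - monom A d ^ 2) i = 0" if "2 * d \<le> i" for i
    using that deg lead
    by (cases "i = 2 * d") (auto simp: monom_power coeff_eq_0 mult.commute)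
  ultimately show ?case
    using A by (intro exI[of _ "monom A d"] exI[of _ 1]) (auto simp: degree_monom_le)
next
  case (Suc k)
  define H where "H = poly_len F"
  define B where "B = (2 * H) ^ (5 ^ k)"
  from Suc obtain P D where IH: "D \<ge> 1" "coeff P d \<ge> 1" "degree P \<le> d" "D \<le> B" "poly_len P \<le> B"
     "\<And>i. 2 * d \<le> i + k \<Longrightarrow> coeff (smult (D ^ 2) F - P ^ 2) i = 0"
    unfolding H_def B_def by auto
  define R where "R = smult (D ^ 2) F - P ^ 2"
  define L where "L = coeff P d"
  \<comment> \<open>\<open>m + d\<close> is \<open>2 * d - Suc k\<close>, the highest index at which
    the remainder may still be nonzero. The correction needed there is \<open>r / (2 * L)\<close>
    times \<open>x^m\<close>, so \<open>P\<close> and \<open>D\<close> are both scaled by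
    \<open>2 * L\<close>.\<close>
  define m where "m = d - Suc k"
  have md: "d = m + Suc k" using Suc.prems by (simp add: m_def)
  define r where "r = coeff R (m + d)"
  \<comment> \<open>\<open>r\<close> is the top coefficient of the remainder, and the cross term \<open>4 L r x^m P\<close> of \<open>P'^2\<close> cancels it.\<close>
  define P' where "P' = smult (2 * L) P + monom r m"
  have "F \<noteq> 0" using lead A by auto
  hence H1: "H \<ge> 1" unfolding H_def by (rule poly_len_pos)
  hence B2: "B \<ge> 2 * H" unfolding B_def by (intro self_le_power) auto
  hence Bpos: "B \<ge> 2" using H1 by auto
  have L: "L \<ge> 1" "L \<le> B"
    using IH abs_coeff_le_poly_len[of P d] by (auto simp: L_def)
  have R3: "poly_len R \<le> B ^ 3"
    unfolding R_def using IH B2 H1 by (intro poly_len_sqrt_remainder) (auto simp: H_def)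
  have r: "\<bar>r\<bar> \<le> B ^ 3" using R3 abs_coeff_le_poly_len[of R "m + d"] by (simp add: r_def)
  have B23: "B * B \<le> B ^ 3" "B ^ 3 \<ge> 0"
    using Bpos by (auto simp: power3_eq_cube)
  have step: "4 * B ^ 3 \<le> (2 * H) ^ (5 ^ Suc k)"
    unfolding B_def using H1 by (intro four_cube_le_pow5) auto
  have "2 * L * D \<le> 2 * B * B" using L IH by (intro mult_mono) auto
  also have "\<dots> \<le> 4 * B ^ 3" using B23 by linarith
  finally have D': "2 * L * D \<le> (2 * H) ^ (5 ^ Suc k)" using step by linarith
  have "poly_len P' \<le> 2 * L * poly_len P + \<bar>r\<bar>"
    unfolding P'_def using poly_len_add[of "smult (2 * L) P" "monom r m"] L
    by (simp add: poly_len_smult)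
  also have "2 * L * poly_len P \<le> 2 * B * B" using L IH by (intro mult_mono) auto
  also have "2 * B * B + \<bar>r\<bar> \<le> 4 * B ^ 3" using B23 r by linarith
  finally have P': "poly_len P' \<le> (2 * H) ^ (5 ^ Suc k)" using step by linarith
  have cP': "coeff P' d \<ge> 1"
  proof -
    have "1 * 1 \<le> 2 * L * L" using L by (intro mult_mono) auto
    thus ?thesis by (simp add: P'_def md L_def)
  qed
  have dP': "degree P' \<le> d"
    unfolding P'_def using IH(3) md
    by (intro degree_add_le) (auto intro: order_trans[OF degree_smult_le] order_trans[OF degree_monom_le])
  have eq: "smult ((2 * L * D) ^ 2) F - P' ^ 2
      = smult (4 * L ^ 2) R - (smult (4 * L) (monom r m * P) + monom (r ^ 2) (2 * m))"
  proof -
    have "smult (2 * L) P ^ 2 = smult (4 * L ^ 2) (P ^ 2)"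
      by (simp add: power2_eq_square)
    moreover have "monom r m ^ 2 = monom (r ^ 2) (2 * m)"
      by (simp add: monom_power mult.commute)
    moreover have "2 * smult (2 * L) P * monom r m
        = smult (2 * L) (monom r m * P) + smult (2 * L) (monom r m * P)"
      by (simp only: mult_2 distrib_right mult_smult_left mult.commute[of P])
    hence "2 * smult (2 * L) P * monom r m = smult (4 * L) (monom r m * P)"
      by (simp flip: smult_add_left)
    ultimately have "P' ^ 2 = smult (4 * L ^ 2) (P ^ 2) + monom (r ^ 2) (2 * m)
        + smult (4 * L) (monom r m * P)"
      unfolding P'_def power2_sum by simp
    moreover have "smult ((2 * L * D) ^ 2) F = smult (4 * L ^ 2) (smult (D ^ 2) F)"
      by (simp add: power_mult_distrib)
    ultimately show ?thesis by (simp add: R_def smult_diff_right)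
  qed
  \<comment> \<open>At index \<open>m + d\<close> the contributions \<open>4 * L ^ 2 * r\<close> and
    \<open>4 * L * (r * L)\<close> cancel, and the monomial of degree \<open>2 * m\<close> lies
    below since \<open>m < d\<close>. At higher indices every term is already zero.\<close>
  have zero: "coeff (smult ((2 * L * D) ^ 2) F - P' ^ 2) i = 0" if i: "2 * d \<le> i + Suc k" for i
  proof (cases "i = m + d")
    case True
    have "coeff (monom r m * P) i = r * L"
      by (simp add: True coeff_monom_mult L_def)
    thus ?thesis unfolding eq using True md by (simp add: r_def power2_eq_square)
  next
    case False
    with i md have i': "m + d < i" by linarith
    have "coeff R i = 0" using IH(6)[of i] i' md unfolding R_def by simp
    moreover have "coeff (monom r m * P) i = 0"
      using i' IH(3) by (simp add: coeff_monom_mult coeff_eq_0)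
    ultimately show ?thesis unfolding eq using i' md by simp
  qed
  have "1 * 1 \<le> 2 * L * D" using L(1) IH(1) by (intro mult_mono) auto
  hence "2 * L * D \<ge> 1" by simp
  with cP' dP' D' P' zero show ?case unfolding H_def
    by (intro exI[of _ P'] exI[of _ "2 * L * D"]) auto
qed

text \<open>With \<open>k = d\<close> the remainder \<open>R = D^2 F - P^2\<close> has degree below
  \<open>d\<close> and is nonzero by \<open>nonsq\<close>. At a point where \<open>F\<close> takes a
  square value, \<open>R(x)\<close> is a difference of two integer squares; if nonzero, it is at
  least \<open>\<bar>P(x)\<bar>\<close> in size. As \<open>P\<close> has degree \<open>d\<close>,
  this fails for large \<open>x\<close>.\<close>

lemma runge_bound:
  fixes F :: "int poly"
  assumes deg: "degree F \<le> 2 * d" and lead: "coeff F (2 * d) = A ^ 2" and A: "A > 0" and d: "d > 0"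
    and nonsq: "\<And>D P. D > 0 \<Longrightarrow> smult (D ^ 2) F \<noteq> P ^ 2"
    and sq: "poly F x = y ^ 2"
  shows "x \<le> (2 * poly_len F) ^ (5 ^ Suc d)"
proof (rule ccontr)
  assume neg: "\<not> x \<le> (2 * poly_len F) ^ (5 ^ Suc d)"
  define H where "H = poly_len F"
  define B where "B = (2 * H) ^ (5 ^ d)"
  from poly_sqrt_approx[OF deg lead A order_refl] obtain P D where
    PD: "D \<ge> 1" "coeff P d \<ge> 1" "degree P \<le> d" "D \<le> B" "poly_len P \<le> B"
     "\<And>i. d \<le> i \<Longrightarrow> coeff (smult (D ^ 2) F - P ^ 2) i = 0"
    unfolding H_def B_def by auto
  define R where "R = smult (D ^ 2) F - P ^ 2"
  obtain e where e: "d = Suc e" using d by (cases d) auto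
  have "F \<noteq> 0" using lead A by auto
  hence H1: "H \<ge> 1" unfolding H_def by (rule poly_len_pos)
  hence B2: "B \<ge> 2 * H" unfolding B_def by (intro self_le_power) auto
  hence Bpos: "B \<ge> 2" using H1 by auto
  have "R \<noteq> 0" using nonsq[of D P] PD(1) by (auto simp: R_def)
  have degR: "degree R \<le> e"
    using PD(6) unfolding R_def e by (intro degree_le) auto
  have R3: "poly_len R \<le> B ^ 3"
    unfolding R_def using PD B2 H1 by (intro poly_len_sqrt_remainder) (auto simp: H_def)
  have B13: "B \<le> B ^ 3" using Bpos by (intro self_le_power) auto
  have "4 * B ^ 3 \<le> (2 * H) ^ (5 ^ Suc d)"
    unfolding B_def using H1 by (intro four_cube_le_pow5) auto
  hence x: "x > 4 * B ^ 3" using neg H_def by simp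
  hence x1: "x \<ge> 1" using Bpos B13 by linarith
  \<comment> \<open>\<open>x\<close> exceeds the root bound \<open>2 * poly_len R\<close>, which is
    at most \<open>2 * B ^ 3\<close>.\<close>
  have "poly R x \<noteq> 0"
    using poly_root_le_poly_len[OF \<open>R \<noteq> 0\<close>, of x] x R3 poly_len_nonneg[of R] by linarith
  moreover have Rx: "poly R x = (D * y) ^ 2 - poly P x ^ 2"
    by (simp add: R_def sq power_mult_distrib)
  ultimately have ne: "\<bar>D * y\<bar> \<noteq> \<bar>poly P x\<bar>" by (metis power2_abs right_minus_eq)
  \<comment> \<open>The distinct integers \<open>\<bar>D * y\<bar>\<close> and
    \<open>\<bar>poly P x\<bar>\<close> differ by at least 1, so the factored difference of squares
    is at least their sum.\<close>
  have "\<bar>poly P x\<bar> \<le> 1 * (\<bar>D * y\<bar> + \<bar>poly P x\<bar>)" by simp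
  also have "\<dots> \<le> \<bar>\<bar>D * y\<bar> - \<bar>poly P x\<bar>\<bar> * (\<bar>D * y\<bar> + \<bar>poly P x\<bar>)"
    using ne by (intro mult_right_mono) auto
  also have "\<dots> = \<bar>(\<bar>D * y\<bar> - \<bar>poly P x\<bar>) * (\<bar>D * y\<bar> + \<bar>poly P x\<bar>)\<bar>"
    by (simp add: abs_mult)
  also have "\<dots> = \<bar>poly R x\<bar>"
    unfolding Rx by (simp add: algebra_simps power2_eq_square flip: abs_mult)
  also have "\<dots> \<le> poly_len R * x ^ e" by (rule abs_poly_le_poly_len[OF x1 degR])
  finally have "(x - 2 * poly_len P) * x ^ e \<le> poly_len R * x ^ e"
    using abs_poly_ge[of x P e] x1 PD(2,3) unfolding e by linarith
  hence "x - 2 * poly_len P \<le> poly_len R" using x1 by simp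
  thus False using x R3 PD(5) B13 Bpos by linarith
qed

section \<open>Square values of \<open>f(x) f(cx)\<close> and the resulting gaps\<close>

text \<open>Consider a root \<open>z\<close> of \<open>f\<close> of maximal modulus, with
  \<open>z \<noteq> 0\<close>. It is a simple root of \<open>f\<close>, and it is no root of
  \<open>f(cX)\<close> because \<open>c * z\<close> is too large to be a root of \<open>f\<close>. A
  root of odd order excludes a square.\<close>

lemma not_square_dilated_product:
  fixes f P :: "complex poly"
  assumes sqf: "rsquarefree f" and deg: "degree f \<ge> 2" and c: "norm c > 1" and b: "b \<noteq> 0"
  shows "smult b (f * pcompose f [:0, c:]) \<noteq> P ^ 2"
proof
  assume eq: "smult b (f * pcompose f [:0, c:]) = P ^ 2"
  have f0: "f \<noteq> 0" using deg by auto
  have c0: "c \<noteq> 0" using c by auto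
  define Z where "Z = {z. poly f z = 0}"
  have finZ: "finite Z" unfolding Z_def using f0 by (rule poly_roots_finite)
  \<comment> \<open>If 0 were the only root, the cofactor \<open>q\<close> of \<open>X\<close> in
    \<open>f\<close> would also vanish at 0, and 0 would be a multiple root.\<close>
  have "\<exists>z\<in>Z. z \<noteq> 0"
  proof (rule ccontr)
    assume neg: "\<not> (\<exists>z\<in>Z. z \<noteq> 0)"
    have "\<exists>z. poly f z = 0"
      using deg by (intro fundamental_theorem_of_algebra_alt) (auto elim!: degree_eq_zeroE)
    with neg have "poly f 0 = 0" by (auto simp: Z_def)
    then obtain q where q: "f = [:0, 1:] * q" by (auto simp: poly_eq_0_iff_dvd elim: dvdE)
    with f0 have q0: "q \<noteq> 0" by auto
    hence "degree q \<ge> 1" using deg unfolding q by (subst (asm) degree_mult_eq) auto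
    hence "\<exists>z. poly q z = 0"
      by (intro fundamental_theorem_of_algebra_alt) (auto elim!: degree_eq_zeroE)
    then obtain z where z: "poly q z = 0" by blast
    hence "z \<in> Z" by (simp add: Z_def q)
    with neg z have "poly q 0 = 0" by auto
    hence "order 0 q \<ge> 1" using q0 order_root[of q 0] by auto
    moreover have "order 0 f = order (0 :: complex) [:0, 1:] + order 0 q"
      unfolding q using q0 by (subst Polynomial.order_mult) auto
    moreover have "order (0::complex) [:0, 1:] \<noteq> 0" using order_root[of "[:0, 1:]" "0::complex"] by simp
    ultimately show False using sqf by (auto simp: rsquarefree_def dest!: spec[of _ 0])
  qed
  then obtain z0 where z0: "z0 \<in> Z" "z0 \<noteq> 0" by blast
  have "Max (norm ` Z) \<in> norm ` Z" using finZ z0(1) by (intro Max_in) auto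
  then obtain z where "z \<in> Z" "norm z = Max (norm ` Z)" by auto
  hence z: "z \<in> Z" "norm w \<le> norm z" if "w \<in> Z" for w
    using finZ that by auto
  have "0 < norm z0" using z0(2) by simp
  also have "\<dots> \<le> norm z" using z0(1) by (rule z(2))
  finally have zpos: "norm z > 0" .
  have fc0: "pcompose f [:0, c:] \<noteq> 0" using f0 c0 by (simp add: pcompose_eq_0_iff)
  have ordz: "order z f = 1"
    using rsquarefree_root_order[OF sqf _ f0] z(1)[OF z0(1)] by (simp add: Z_def)
  have "order z (P ^ 2) = 1 + order z (pcompose f [:0, c:])"
    unfolding eq [symmetric] using Polynomial.order_mult[of f "pcompose f [:0, c:]" z] f0 fc0 ordz
    by (simp only: Polynomial.order_smult[OF b] mult_eq_0_iff simp_thms)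
  moreover have "P \<noteq> 0" using eq f0 fc0 b by auto
  hence "order z (P ^ 2) = 2 * order z P" by (simp add: Polynomial.order_mult power2_eq_square)
  \<comment> \<open>An even number equals 1 plus this order, so the order is odd.\<close>
  ultimately have "order z (pcompose f [:0, c:]) \<noteq> 0" by presburger
  hence "poly f (c * z) = 0" using order_root[of "pcompose f [:0, c:]" z] by (simp add: poly_pcompose mult.commute)
  hence "norm (c * z) \<le> norm z" using z(2) by (simp add: Z_def)
  thus False using c zpos by (simp add: norm_mult)
qed

lemma poly_len_pcompose_dilation:
  assumes "G \<ge> 1" "degree p \<le> d"
  shows "poly_len (pcompose p [:0, G:]) \<le> G ^ d * poly_len p"
  using assms(2)
proof (induction p arbitrary: d)
  case (pCons a p)
  have one: "1 \<le> G ^ d" using assms(1) by simp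
  show ?case
  proof (cases "p = 0")
    case True
    thus ?thesis using mult_right_mono[OF one, of "\<bar>a\<bar>"] by (simp add: pcompose_pCons)
  next
    case False
    then obtain e where e: "d = Suc e" "degree p \<le> e"
      using pCons.prems by (cases d) auto
    have "poly_len (pcompose (pCons a p) [:0, G:]) = \<bar>a\<bar> + G * poly_len (pcompose p [:0, G:])"
      using assms(1) by (simp add: pcompose_pCons poly_len_smult)
    also have "\<dots> \<le> G ^ d * \<bar>a\<bar> + G * (G ^ e * poly_len p)"
      using assms(1) mult_right_mono[OF one, of "\<bar>a\<bar>"] pCons.IH[OF e(2)]
      by (intro add_mono mult_left_mono) auto
    finally show ?thesis by (simp add: e algebra_simps)
  qed
qed simp

lemma map_poly_of_int_mult:
  "map_poly of_int (p * q) = (map_poly of_int p * map_poly of_int q :: 'a :: comm_ring_1 poly)"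
  by (intro poly_eqI) (simp add: coeff_map_poly coeff_mult)

lemma map_poly_of_int_smult:
  "map_poly of_int (smult c p) = (smult (of_int c) (map_poly of_int p) :: 'a :: comm_ring_1 poly)"
  by (intro poly_eqI) (simp add: coeff_map_poly)

text \<open>Runge's bound for \<open>F(X) = f(X) f(g^h X)\<close> at \<open>X = g^n\<close>. The
  length of \<open>F\<close> is at most \<open>g^(c + h d)\<close> and the exponent \<open>E\<close>
  depends only on the degree, so comparing exponents of \<open>g\<close> gives a bound linear in
  \<open>h\<close>, with a constant independent of \<open>n\<close> and \<open>h\<close>.\<close>

lemma dilated_square_gap:
  fixes f :: "int poly" and g :: int
  assumes g: "g > 1" and deg: "degree f \<ge> 2" and lead: "lead_coeff f > 0"
    and roots: "rsquarefree (map_poly of_int f :: complex poly)"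
  obtains C :: nat where "C \<ge> 1"
    "\<And>n h y. \<lbrakk>even h; h \<ge> 1; poly f (g ^ n) * poly f (g ^ (n + h)) = y ^ 2\<rbrakk> \<Longrightarrow> n \<le> C * h"
proof -
  define d where "d = degree f"
  define c where "c = nat (2 * poly_len f ^ 2)"
  define E :: nat where "E = 5 ^ Suc d"
  have "f \<noteq> 0" using deg by auto
  have c: "2 * poly_len f ^ 2 \<le> g ^ c"
  proof -
    have "int c < 2 ^ c" by (rule of_nat_less_two_power)
    also have "(2::int) ^ c \<le> g ^ c" using g by (intro power_mono) auto
    finally show ?thesis by (simp add: c_def)
  qed
  show ?thesis
  proof (rule that[of "(c + d) * E"])
    show "(c + d) * E \<ge> 1" using deg by (simp add: d_def E_def)
  next
    fix n h :: nat and y :: int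
    assume h: "even h" "h \<ge> 1" and y: "poly f (g ^ n) * poly f (g ^ (n + h)) = y ^ 2"
    from h obtain k where k: "h = 2 * k" by (elim evenE)
    define G where "G = g ^ h"
    have G1: "G > 1" unfolding G_def using g h by (intro one_less_power) auto
    define F where "F = f * pcompose f [:0, G:]"
    \<comment> \<open>Here evenness of \<open>h\<close> enters: the top coefficient of
      \<open>F\<close> is \<open>lead_coeff f ^ 2 * g ^ (h * d)\<close>, whose square root is
      integral because \<open>h = 2 * k\<close>.\<close>
    define A where "A = lead_coeff f * g ^ (k * d)"
    have degG: "degree (pcompose f [:0, G:]) = d"
      using G1 by (simp add: degree_pcompose d_def)
    have 1: "degree F \<le> 2 * d"
      unfolding F_def using degree_mult_le[of f "pcompose f [:0, G:]"] degG by (simp add: d_def)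
    have "coeff F (2 * d) = lead_coeff f * coeff (pcompose f [:0, G:]) d"
      using coeff_mult_degree_sum[of f "pcompose f [:0, G:]"] unfolding F_def degG
      by (simp add: d_def mult_2)
    also have "\<dots> = lead_coeff f * (G ^ d * lead_coeff f)"
      by (simp only: coeff_pcompose_linear d_def)
    also have "\<dots> = A ^ 2"
      by (simp add: A_def G_def k power2_eq_square mult_2_right mult_ac distrib_left
            flip: power_mult power_add)
    finally have 2: "coeff F (2 * d) = A ^ 2" .
    have 3: "A > 0" unfolding A_def using lead g by simp
    have 4: "d > 0" using deg by (simp add: d_def)
    have 5: "smult (D ^ 2) F \<noteq> P ^ 2" if "D > 0" for D P
    proof
      assume "smult (D ^ 2) F = P ^ 2"
      hence "map_poly of_int (smult (D ^ 2) F) = (map_poly of_int (P * P) :: complex poly)"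
        by (simp add: power2_eq_square)
      hence "smult (of_int (D ^ 2)) (map_poly of_int F) = (map_poly of_int P ^ 2 :: complex poly)"
        by (simp only: map_poly_of_int_mult map_poly_of_int_smult power2_eq_square)
      moreover have "map_poly of_int F
          = map_poly of_int f * pcompose (map_poly of_int f :: complex poly) [:0, of_int G:]"
        unfolding F_def map_poly_of_int_mult
        by (intro arg_cong2[of _ _ _ _ "(*)"] poly_eqI)
           (simp_all add: coeff_map_poly coeff_pcompose_linear)
      moreover have "degree (map_poly of_int f :: complex poly) \<ge> 2"
        using deg by (subst degree_map_poly) auto
      moreover have "norm (of_int G :: complex) > 1" using G1 by simp
      ultimately show False using not_square_dilated_product[OF roots] that by force
    qed
    have 6: "poly F (g ^ n) = y ^ 2"
      using y by (simp add: F_def poly_pcompose G_def power_add)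
    have "poly_len F \<le> poly_len f * poly_len (pcompose f [:0, G:])"
      unfolding F_def by (rule poly_len_mult)
    also have "\<dots> \<le> poly_len f * (G ^ d * poly_len f)"
      using G1 by (intro mult_left_mono poly_len_pcompose_dilation) (auto simp: d_def)
    finally have "2 * poly_len F \<le> (2 * poly_len f ^ 2) * G ^ d" by (simp add: power2_eq_square mult_ac)
    also have "\<dots> \<le> g ^ c * G ^ d" using c G1 by (intro mult_right_mono) auto
    also have "\<dots> = g ^ (c + h * d)" by (simp add: G_def power_add flip: power_mult)
    finally have len: "2 * poly_len F \<le> g ^ (c + h * d)" .
    have "g ^ n \<le> (2 * poly_len F) ^ E"
      unfolding E_def by (rule runge_bound[OF 1 2 3 4 5 6])
    also have "\<dots> \<le> (g ^ (c + h * d)) ^ E" using len by (intro power_mono) auto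
    finally have "g ^ n \<le> g ^ ((c + h * d) * E)" by (simp only: power_mult)
    hence "n \<le> (c + h * d) * E" using g by simp
    \<comment> \<open>\<open>h \<ge> 1\<close> lets \<open>c\<close> be absorbed into
      \<open>c * h\<close>.\<close>
    also have "\<dots> \<le> ((c + d) * h) * E"
      using h by (intro mult_right_mono) (auto simp: algebra_simps)
    finally show "n \<le> (c + d) * E * h" by (simp add: mult_ac)
  qed
qed

section \<open>Counting sets that grow geometrically\<close>

text \<open>The gap condition says \<open>n \<ge> (1 + 1 / C) * m\<close>, so logarithms to the base
  \<open>1 + 1 / C\<close> are spaced by at least 1. The restriction \<open>n - m < N\<close> then
  bounds every element but the largest by \<open>C * N\<close>, wherever the window lies. The
  summand 2 accounts for the largest element and for the value 0 of the rounded logarithm.\<close>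

lemma card_le_of_gaps:
  fixes A :: "nat set" and C N :: nat
  assumes fin: "finite A" and pos: "0 \<notin> A" and C: "C \<ge> 1" and N: "N \<ge> 1"
    and gap: "\<And>m n. \<lbrakk>m \<in> A; n \<in> A; m < n\<rbrakk> \<Longrightarrow> m \<le> C * (n - m) \<and> n - m < N"
  shows "real (card A) \<le> 2 + ln (real (C * N)) / ln (1 + 1 / real C)"
proof -
  define \<theta> where "\<theta> = ln (1 + 1 / real C)"
  have \<theta>: "\<theta> > 0" unfolding \<theta>_def using C by (intro ln_gt_zero) simp
  have CN: "real (C * N) \<ge> 1" using C N by (metis mult_le_mono nat_mult_1 of_nat_1 of_nat_le_iff)
  have t0: "ln (real (C * N)) / \<theta> \<ge> 0" using CN \<theta> by (intro divide_nonneg_pos ln_ge_zero)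
  show ?thesis
  proof (cases "A = {}")
    case True
    thus ?thesis using t0 by (simp add: \<theta>_def)
  next
    case False
    \<comment> \<open>The maximum has no larger partner, so the gap condition gives no upper bound
      for it; every other element is compared with it.\<close>
    define B where "B = A - {Max A}"
    define \<phi> where "\<phi> n = nat \<lfloor>ln (real n) / \<theta>\<rfloor>" for n :: nat
    have B: "1 \<le> n" "n \<le> C * N" if "n \<in> B" for n
    proof -
      have "n \<in> A" "n < Max A" using that fin by (auto simp: B_def order_le_neq_trans)
      with gap[of n "Max A"] fin False have "n \<le> C * (Max A - n)" "Max A - n < N" by auto
      thus "n \<le> C * N" by (meson less_imp_le mult_le_mono2 order_trans)
      show "1 \<le> n" using \<open>n \<in> A\<close> pos by (cases n) auto
    qed
    have less: "\<phi> m < \<phi> n" if mn: "m \<in> B" "n \<in> B" "m < n" for m n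
    proof -
      have "m \<le> C * (n - m)" using gap[of m n] mn by (auto simp: B_def)
      hence "real m \<le> real C * (real n - real m)"
        using mn(3) by (metis less_imp_le of_nat_diff of_nat_le_iff of_nat_mult)
      hence "real m / real C \<le> real n - real m"
        using C by (subst divide_le_eq) (simp add: mult.commute)
      hence "(1 + 1 / real C) * real m \<le> real n" by (simp add: distrib_right)
      moreover have m1: "real m \<ge> 1" "real n \<ge> 1" using B(1) mn by force+
      moreover have "(1 + 1 / real C) * real m > 0" using m1 by (intro mult_pos_pos add_pos_nonneg) auto
      ultimately have "ln ((1 + 1 / real C) * real m) \<le> ln (real n)"
        by (subst ln_le_cancel_iff) (linarith | assumption)+
      moreover have "1 + 1 / real C > 0" by (intro add_pos_nonneg) auto
      hence "ln ((1 + 1 / real C) * real m) = \<theta> + ln (real m)"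
        unfolding \<theta>_def using m1 by (intro ln_mult_pos) linarith+
      ultimately have "\<theta> + ln (real m) \<le> ln (real n)" by linarith
      hence "ln (real m) / \<theta> + 1 \<le> ln (real n) / \<theta>" using \<theta> by (simp add: field_simps)
      moreover have "ln (real m) / \<theta> \<ge> 0" using m1 \<theta> by (intro divide_nonneg_pos ln_ge_zero)
      ultimately show ?thesis unfolding \<phi>_def by linarith
    qed
    have "inj_on \<phi> B" 
    proof (rule inj_onI, rule ccontr)
      fix m n assume "m \<in> B" "n \<in> B" "\<phi> m = \<phi> n" "m \<noteq> n"
      thus False using less[of m n] less[of n m] by (cases m n rule: linorder_cases) simp_all
    qed
    moreover have "\<phi> ` B \<subseteq> {..nat \<lfloor>ln (real (C * N)) / \<theta>\<rfloor>}"
    proof safe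
      fix n assume "n \<in> B"
      hence "ln (real n) \<le> ln (real (C * N))" using B[of n] C N
        by (subst ln_le_cancel_iff) (simp_all del: of_nat_mult)
      hence "ln (real n) / \<theta> \<le> ln (real (C * N)) / \<theta>" using \<theta> by (intro divide_right_mono) auto
      thus "\<phi> n \<le> nat \<lfloor>ln (real (C * N)) / \<theta>\<rfloor>"
        unfolding \<phi>_def by (intro nat_mono floor_mono)
    qed
    ultimately have "card B \<le> nat \<lfloor>ln (real (C * N)) / \<theta>\<rfloor> + 1"
      using card_inj_on_le[of \<phi> B "{..nat \<lfloor>ln (real (C * N)) / \<theta>\<rfloor>}"] by simp
    hence "real (card B) \<le> ln (real (C * N)) / \<theta> + 1" using t0 by linarith
    moreover have "card A = Suc (card B)"
      unfolding B_def using fin False by (metis Max_in card.remove)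
    ultimately show ?thesis by (simp add: \<theta>_def)
  qed
qed

section \<open>Equality of quadratic fields\<close>

text \<open>Induction over the generation of the field: the numbers \<open>p + q * w\<close> with
  rational \<open>p\<close>, \<open>q\<close> and \<open>w = csqrt (of_int a)\<close> are closed
  under all field operations.\<close>

lemma Q_sqrt_elem:
  assumes "x \<in> Q_sqrt a"
  obtains p q where "p \<in> \<rat>" "q \<in> \<rat>" "x = p + q * csqrt (of_int a)"
proof -
  define w where "w = csqrt (of_int a)"
  have w2: "w * w = of_int a" by (simp add: w_def flip: power2_eq_square)
  interpret R: Ring.field "ring_of_type_algebra :: complex ring" by (rule field_from_type_algebra)
  have [simp]: "carrier (ring_of_type_algebra :: complex ring) = UNIV"
    "x \<otimes>\<^bsub>(ring_of_type_algebra :: complex ring)\<^esub> y = x * y"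
    "x \<oplus>\<^bsub>(ring_of_type_algebra :: complex ring)\<^esub> y = x + y"
    "\<one>\<^bsub>(ring_of_type_algebra :: complex ring)\<^esub> = 1"
    "\<zero>\<^bsub>(ring_of_type_algebra :: complex ring)\<^esub> = 0" for x y
    by (simp_all add: ring_of_type_algebra_def)
  have uminus: "\<ominus>\<^bsub>(ring_of_type_algebra :: complex ring)\<^esub> x = - x" for x
    using R.l_neg[of x] by (simp add: eq_neg_iff_add_eq_0)
  have inverse: "inv\<^bsub>(ring_of_type_algebra :: complex ring)\<^esub> x = inverse x" if "x \<noteq> 0" for x
    using that by (intro R.comm_inv_char) auto
  have "\<exists>p\<in>\<rat>. \<exists>q\<in>\<rat>. x = p + q * w"
    using assms unfolding Q_sqrt_def w_def [symmetric]
  proof (induction rule: generate_field.induct)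
    case one
    show ?case by (intro bexI[of _ 1] bexI[of _ 0]) auto
  next
    case (incl x)
    thus ?case by (intro bexI[of _ 0] bexI[of _ 1]) auto
  next
    case (a_inv x)
    then obtain p q where "p \<in> \<rat>" "q \<in> \<rat>" "x = p + q * w" by blast
    thus ?case by (intro bexI[of _ "-p"] bexI[of _ "-q"]) (auto simp: uminus)
  next
    case (m_inv x)
    then obtain p q where pq: "p \<in> \<rat>" "q \<in> \<rat>" "x = p + q * w" by blast
    have x0: "x \<noteq> 0" using m_inv by simp
    \<comment> \<open>The norm of \<open>x\<close>; the inverse is the conjugate divided by it. It
      can vanish for \<open>x \<noteq> 0\<close>, as \<open>w\<close> may be rational; then the
      conjugate is 0 and \<open>x = 2 * p\<close>.\<close>
    define r where "r = p * p - q * q * of_int a"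
    have r: "r \<in> \<rat>" unfolding r_def using pq by auto
    have req: "r = x * (p - q * w)" unfolding r_def pq(3) w2 [symmetric] by (simp add: algebra_simps)
    show ?case
    proof (cases "r = 0")
      case True
      hence "p = q * w" using req x0 by simp
      hence "x = 2 * p" using pq by simp
      thus ?thesis using pq(1) x0 by (intro bexI[of _ "inverse x"] bexI[of _ 0]) (auto simp: inverse)
    next
      case False
      hence "inverse x = (p - q * w) / r" using x0 req by (simp add: inverse_eq_divide)
      also have "\<dots> = p / r + (- q / r) * w" by (simp add: diff_divide_distrib)
      finally have "inverse x = p / r + (- q / r) * w" .
      thus ?thesis using pq(1,2) r x0
        by (intro bexI[of _ "p / r"] bexI[of _ "- q / r"]) (auto simp: inverse)
    qed
  next
    case (eng_add x y)
    then obtain p q p' q' where "p \<in> \<rat>" "q \<in> \<rat>" "p' \<in> \<rat>" "q' \<in> \<rat>" "x = p + q * w" "y = p' + q' * w" by blast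
    thus ?case by (intro bexI[of _ "p + p'"] bexI[of _ "q + q'"]) (auto simp: algebra_simps)
  next
    case (eng_mult x y)
    then obtain p q p' q' where *: "p \<in> \<rat>" "q \<in> \<rat>" "p' \<in> \<rat>" "q' \<in> \<rat>" "x = p + q * w" "y = p' + q' * w" by blast
    have "x * y = (p * p' + q * q' * (w * w)) + (p * q' + p' * q) * w"
      by (simp add: * algebra_simps)
    thus ?case using * unfolding w2
      by (intro bexI[of _ "p * p' + q * q' * of_int a"] bexI[of _ "p * q' + p' * q"]) auto
  qed
  thus ?thesis using that unfolding w_def by blast
qed

lemma rat_square_of_int:
  fixes z :: "'a :: field_char_0"
  assumes "z \<in> \<rat>" "z ^ 2 = of_int m"
  obtains c where "m = c ^ 2"
proof -
  from assms(1) obtain a b where ab: "b > 0" "coprime a b" "z = of_int a / of_int b"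
    by (rule Rats_cases')
  hence "of_int a = z * of_int b" by simp
  hence "(of_int a) ^ 2 = (of_int m * of_int b ^ 2 :: 'a)"
    using assms(2) by (simp add: power_mult_distrib)
  hence eq: "a ^ 2 = m * b ^ 2" by (metis (no_types) of_int_eq_iff of_int_mult of_int_power)
  hence "b ^ 2 dvd a ^ 2" by simp
  hence "b dvd a" by simp
  with ab have "b = 1" by (metis coprime_common_divisor dvd_refl zdvd1_eq abs_of_pos)
  with eq show ?thesis using that by auto
qed

text \<open>With \<open>v\<close>, \<open>w\<close> the two roots, it suffices that
  \<open>v * w\<close> is rational, since its square is the integer \<open>a * b\<close>. If
  \<open>w\<close> is irrational, squaring \<open>v = p + q * w\<close> forces
  \<open>p * q = 0\<close>; as \<open>v\<close> is irrational too, \<open>q \<noteq> 0\<close>, and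
  so \<open>v = q * w\<close>.\<close>

lemma Q_sqrt_eq_imp_square:
  assumes "Q_sqrt a = Q_sqrt b"
  obtains c where "a * b = c ^ 2"
proof -
  define v w where "v = csqrt (of_int a)" and "w = csqrt (of_int b)"
  have sq: "v ^ 2 = of_int a" "w ^ 2 = of_int b" by (simp_all add: v_def w_def)
  have "v \<in> Q_sqrt a" "w \<in> Q_sqrt b"
    unfolding Q_sqrt_def v_def w_def by (auto intro: generate_field.incl)
  hence "v \<in> Q_sqrt b" "w \<in> Q_sqrt a" using assms by auto
  then obtain p q r t where pq: "p \<in> \<rat>" "q \<in> \<rat>" "v = p + q * w"
      and rt: "r \<in> \<rat>" "t \<in> \<rat>" "w = r + t * v"
    unfolding v_def w_def by (metis Q_sqrt_elem)
  have vw: "v \<in> \<rat> \<longleftrightarrow> w \<in> \<rat>" using pq rt by (metis Rats_add Rats_mult)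
  have "v * w \<in> \<rat>"
  proof (cases "w \<in> \<rat>")
    case True
    thus ?thesis using vw by simp
  next
    case False
    have "of_int a = p ^ 2 + q ^ 2 * of_int b + 2 * p * q * w"
      unfolding sq [symmetric] pq(3) by (simp add: power2_eq_square algebra_simps)
    hence eq: "2 * p * q * w = of_int a - p ^ 2 - q ^ 2 * of_int b" by simp
    have "p * q = 0"
    proof (rule ccontr)
      assume "p * q \<noteq> 0"
      hence "w = (of_int a - p ^ 2 - q ^ 2 * of_int b) / (2 * p * q)"
        using eq by (simp add: field_simps)
      also have "\<dots> \<in> \<rat>" using pq(1,2) by auto
      finally show False using False by simp
    qed
    moreover have "q \<noteq> 0" using False pq vw by auto
    ultimately have "v * w = q * of_int b" using pq(3) by (simp add: power2_eq_square flip: sq)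
    thus ?thesis using pq by auto
  qed
  moreover have "(v * w) ^ 2 = of_int (a * b)" by (simp add: power_mult_distrib sq)
  ultimately show ?thesis using rat_square_of_int that by blast
qed

text \<open>At each prime the two multiplicities are at most 1 and have an even sum, so they agree;
  positivity fixes the sign.\<close>

lemma squarefree_mult_eq_square:
  fixes s t :: int
  assumes "squarefree s" "squarefree t" "s > 0" "t > 0" "s * t = c ^ 2"
  shows "s = t"
proof -
  have *: "multiplicity p s = multiplicity p t" if p: "prime p" for p :: int
  proof -
    have "multiplicity p s + multiplicity p t = 2 * multiplicity p c"
      using assms p
      by (metis prime_imp_prime_elem less_irrefl prime_elem_multiplicity_mult_distrib
          prime_elem_multiplicity_power_distrib mult_eq_0_iff power_eq_0_iff pos2)
    moreover have "multiplicity p s \<le> 1" "multiplicity p t \<le> 1"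
      using assms p by (auto simp: squarefree_factorial_semiring'')
    ultimately show ?thesis by presburger
  qed
  have "normalize s = normalize t" using assms * by (intro multiplicity_eq_imp_eq) auto
  thus ?thesis using assms by simp
qed

section \<open>Bounds for \<open>Q_count\<close> and \<open>Q_total\<close>\<close>

lemma card_nat_window:
  "finite {n::nat. n \<ge> 1 \<and> int n \<in> {M + 1..M + int N}}" (is "finite ?W")
  "card {n::nat. n \<ge> 1 \<and> int n \<in> {M + 1..M + int N}} \<le> N"
proof -
  have sub: "int ` ?W \<subseteq> {M + 1..M + int N}" by auto
  show "finite ?W" using finite_subset[OF sub] by (simp add: finite_image_iff)
  have "card ?W = card (int ` ?W)" by (simp add: card_image)
  also have "\<dots> \<le> card {M + 1..M + int N}" using sub by (intro card_mono) auto
  finally show "card ?W \<le> N" by simp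
qed

text \<open>Distinct positive squarefree \<open>s\<close> give distinct fields, so the sets being
  counted are disjoint subsets of one window.\<close>

lemma Q_total_le_length: "Q_total u M N S \<le> N"
proof -
  define W where "W s = {n::nat. n \<ge> 1 \<and> int n \<in> {M + 1..M + int N} \<and> Q_sqrt (u n) = Q_sqrt s}" for s
  define T where "T = {s::int. 1 \<le> s \<and> s \<le> int S \<and> squarefree s}"
  have T: "finite T" by (rule finite_subset[of _ "{1..int S}"]) (auto simp: T_def)
  have W: "W s \<subseteq> {n::nat. n \<ge> 1 \<and> int n \<in> {M + 1..M + int N}}" for s by (auto simp: W_def)
  have "Q_total u M N S = (\<Sum>s\<in>T. card (W s))"
    by (simp add: Q_total_def Q_count_def T_def W_def)
  also have "\<dots> = card (\<Union>s\<in>T. W s)"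
  proof (rule card_UN_disjoint [symmetric, OF T])
    show "\<forall>s\<in>T. finite (W s)" using finite_subset[OF W card_nat_window(1)] by blast
    show "\<forall>s\<in>T. \<forall>t\<in>T. s \<noteq> t \<longrightarrow> W s \<inter> W t = {}"
    proof (intro ballI impI)
      fix s t assume st: "s \<in> T" "t \<in> T" "s \<noteq> t"
      have "Q_sqrt s \<noteq> Q_sqrt t"
      proof
        assume "Q_sqrt s = Q_sqrt t"
        then obtain c where "s * t = c ^ 2" by (rule Q_sqrt_eq_imp_square)
        with st squarefree_mult_eq_square[of s t c] show False by (auto simp: T_def)
      qed
      thus "W s \<inter> W t = {}" by (auto simp: W_def)
    qed
  qed
  also have "\<dots> \<le> card {n::nat. n \<ge> 1 \<and> int n \<in> {M + 1..M + int N}}"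
    using W by (intro card_mono card_nat_window UN_least)
  finally show ?thesis using card_nat_window(2) order_trans by blast
qed

text \<open>Two indices with the same field make the product of their values a square, so
  \<open>dilated_square_gap\<close> supplies the gaps for \<open>card_le_of_gaps\<close>. Even
  differences are ensured by treating even and odd indices separately. The constant is uniform in
  \<open>M\<close> and \<open>s\<close>.\<close>

lemma Q_count_exp_poly_le:
  fixes f :: "int poly" and g :: int
  assumes g: "g > 1" and deg: "degree f \<ge> 2" and lead: "lead_coeff f > 0"
    and roots: "rsquarefree (map_poly of_int f :: complex poly)"
  obtains K :: real where "K \<ge> 1"
    "\<And>M N s. N \<ge> 1 \<Longrightarrow> real (Q_count (\<lambda>n. poly f (g ^ n)) M N s) \<le> K * (1 + ln (real N))"
proof -
  from dilated_square_gap[OF assms] obtain C :: nat where C: "C \<ge> 1"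
    "\<And>n h y. \<lbrakk>even h; h \<ge> 1; poly f (g ^ n) * poly f (g ^ (n + h)) = y ^ 2\<rbrakk> \<Longrightarrow> n \<le> C * h"
    by blast
  define \<theta> where "\<theta> = ln (1 + 1 / real C)"
  have \<theta>: "\<theta> > 0" unfolding \<theta>_def using C(1) by (intro ln_gt_zero) simp
  have lnC: "ln (real C) \<ge> 0" using C(1) by simp
  \<comment> \<open>The sum of the constant term and the coefficient of \<open>ln N\<close> in the
    final estimate, so that it dominates each of them.\<close>
  define K where "K = 4 + 2 * ln (real C) / \<theta> + 2 / \<theta>"
  show ?thesis
  proof (rule that[of K])
    show "K \<ge> 1" unfolding K_def using \<theta> lnC
      by (smt (verit) divide_nonneg_pos)
  next
    fix M :: int and N :: nat and s :: int
    assume N: "N \<ge> 1"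
    define W where "W = {n::nat. n \<ge> 1 \<and> int n \<in> {M + 1..M + int N} \<and> Q_sqrt (poly f (g ^ n)) = Q_sqrt s}"
    have finX: "finite W"
      by (rule finite_subset[OF _ card_nat_window(1)[of M N]]) (auto simp: W_def)
    have bound: "real (card (W \<inter> Collect P)) \<le> 2 + ln (real (C * N)) / \<theta>"
      if P: "\<And>m n. \<lbrakk>P m; P n; m < n\<rbrakk> \<Longrightarrow> even (n - m)" for P
      unfolding \<theta>_def
    proof (rule card_le_of_gaps[OF _ _ C(1) N])
      fix m n assume mn: "m \<in> W \<inter> Collect P" "n \<in> W \<inter> Collect P" "m < n"
      hence "Q_sqrt (poly f (g ^ m)) = Q_sqrt (poly f (g ^ n))" by (auto simp: W_def)
      then obtain y where "poly f (g ^ m) * poly f (g ^ n) = y ^ 2" by (rule Q_sqrt_eq_imp_square)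
      hence "m \<le> C * (n - m)" using mn P[of m n] by (intro C(2)[of _ _ y]) auto
      moreover have "n - m < N" using mn by (auto simp: W_def)
      ultimately show "m \<le> C * (n - m) \<and> n - m < N" ..
    qed (use finX in \<open>auto simp: W_def\<close>)
    have "card W \<le> card (W \<inter> Collect even) + card (W \<inter> Collect odd)"
      using card_Un_le[of "W \<inter> Collect even" "W \<inter> Collect odd"]
      by (simp add: Int_Un_distrib[symmetric] Collect_disj_eq[symmetric])
    hence "real (card W) \<le> real (card (W \<inter> Collect even)) + real (card (W \<inter> Collect odd))" by linarith
    also have "\<dots> \<le> (2 + ln (real (C * N)) / \<theta>) + (2 + ln (real (C * N)) / \<theta>)"
      by (intro add_mono bound) auto
    also have "ln (real (C * N)) = ln (real C) + ln (real N)" using C(1) N by (simp add: ln_mult)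
    also have "(2 + (ln (real C) + ln (real N)) / \<theta>) + (2 + (ln (real C) + ln (real N)) / \<theta>)
        = (4 + 2 * ln (real C) / \<theta>) * 1 + (2 / \<theta>) * ln (real N)"
      by (simp add: add_divide_distrib)
    also have "\<dots> \<le> K * 1 + K * ln (real N)"
    proof (rule add_mono; rule mult_right_mono)
      have "2 * ln (real C) / \<theta> \<ge> 0" "2 / \<theta> \<ge> 0" using \<theta> lnC by auto
      thus "4 + 2 * ln (real C) / \<theta> \<le> K" "2 / \<theta> \<le> K" unfolding K_def by linarith+
    qed (use N in auto)
    finally show "real (Q_count (\<lambda>n. poly f (g ^ n)) M N s) \<le> K * (1 + ln (real N))"
      by (simp add: Q_count_def W_def algebra_simps)
  qed
qed

lemma Q_total_le_mult:
  assumes "\<And>s. real (Q_count u M N s) \<le> B" "B \<ge> 0"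
  shows "real (Q_total u M N S) \<le> real S * B"
proof -
  define T where "T = {s::int. 1 \<le> s \<and> s \<le> int S \<and> squarefree s}"
  have "card T \<le> card {1..int S}" by (intro card_mono) (auto simp: T_def)
  hence T: "card T \<le> S" by simp
  have "real (Q_total u M N S) = (\<Sum>s\<in>T. real (Q_count u M N s))"
    by (simp add: Q_total_def T_def)
  also have "\<dots> \<le> real (card T) * B" by (rule sum_bounded_above) (rule assms(1))
  also have "\<dots> \<le> real S * B" using T assms(2) by (intro mult_right_mono) auto
  finally show ?thesis .
qed

section \<open>Range of the exponent \<alpha> and comparison with the claimed bound\<close>

text \<open>The minimum is at least 1, so raising it to the power \<open>x + y \<ge> 1\<close> does
  not decrease it; the two factors are then bounded separately by \<open>a\<close> and
  \<open>b\<close>.\<close>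

lemma min_le_powr_mult_powr:
  fixes a b x y :: real
  assumes "a \<ge> 1" "b \<ge> 1" "x \<ge> 0" "y \<ge> 0" "x + y \<ge> 1"
  shows "min a b \<le> a powr x * b powr y"
proof -
  define m where "m = min a b"
  have m: "m \<ge> 1" "m \<le> a" "m \<le> b" using assms by (auto simp: m_def)
  have "m = m powr 1" using m by simp
  also have "\<dots> \<le> m powr (x + y)" using m assms by (intro powr_mono) auto
  also have "\<dots> = m powr x * m powr y" by (rule powr_add)
  also have "\<dots> \<le> a powr x * b powr y"
    using m assms by (intro mult_mono powr_mono2) auto
  finally show ?thesis by (simp add: m_def)
qed

text \<open>For \<open>\<alpha> \<ge> 1\<close> the set of primes would be empty, since the largest
  prime factor of \<open>l - 1\<close> is below \<open>l\<close>, contradicting a lower bound of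
  order \<open>z / ln z\<close>.\<close>

lemma shifted_primes_exponent_less_1:
  fixes \<alpha> :: real
  assumes "\<exists>c>0. \<forall>\<^sub>F z::real in at_top.
      z / ln z \<le> c * real (card {l::nat. prime l \<and> real l \<le> z \<and> real (P_plus (l - 1)) \<ge> real l powr \<alpha>})"
  shows "\<alpha> < 1"
proof (rule ccontr)
  assume "\<not> \<alpha> < 1"
  have small: "real (P_plus (l - 1)) < real l powr \<alpha>" if l: "prime l" for l :: nat
  proof -
    have l2: "l \<ge> 2" using l by (rule prime_ge_2_nat)
    \<comment> \<open>For \<open>l = 2\<close> this rests on the convention
      \<open>P_plus 1 = 1\<close>.\<close>
    have "P_plus (l - 1) < l"
    proof (cases "l - 1 \<ge> 2")
      case True
      hence "prime_factors (l - 1) \<noteq> {}"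
        using prime_factor_nat[of "l - 1"] by (auto simp: prime_factors_dvd)
      hence "Max (prime_factors (l - 1)) \<in> prime_factors (l - 1)" by (intro Max_in) auto
      hence "Max (prime_factors (l - 1)) dvd l - 1" by (rule in_prime_factors_imp_dvd)
      hence "Max (prime_factors (l - 1)) \<le> l - 1" using True by (intro dvd_imp_le) auto
      thus ?thesis using True by (simp add: P_plus_def)
    qed (use l2 in \<open>simp add: P_plus_def\<close>)
    also have "real l = real l powr 1" by simp
    hence "real l \<le> real l powr \<alpha>"
      using \<open>\<not> \<alpha> < 1\<close> l2 powr_mono[of 1 \<alpha> "real l"] by simp
    finally show ?thesis by simp
  qed
  have empty: "{l::nat. prime l \<and> real l \<le> z \<and> real (P_plus (l - 1)) \<ge> real l powr \<alpha>} = {}" for z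
    using small by (auto simp: not_le)
  from assms have "\<forall>\<^sub>F z::real in at_top. z / ln z \<le> 0"
    unfolding empty by (simp add: ex_in_conv)
  hence "\<forall>\<^sub>F z::real in at_top. False"
    using eventually_gt_at_top[of 1]
  proof eventually_elim
    case (elim z)
    have "z / ln z > 0" using elim(2) by (intro divide_pos_pos ln_gt_zero) auto
    with elim(1) show False by linarith
  qed
  thus False by simp
qed

theorem theorem1p3:
  fixes g :: int and f :: "int poly" and \<alpha> :: real
  assumes g: "g > 1"
    and deg: "degree f \<ge> 3"
    and lead: "lead_coeff f > 0"
    and roots: "rsquarefree (map_poly of_int f :: complex poly)"
    and \<alpha>: "\<alpha> > 0"
    and shifted_primes: "\<exists>c>0. \<forall>\<^sub>F z::real in at_top.
      z / ln z \<le> c * real (card {l::nat. prime l \<and> real l \<le> z \<and> real (P_plus (l - 1)) \<ge> real l powr \<alpha>})"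
  shows "\<exists>\<epsilon> :: nat \<Rightarrow> real. \<epsilon> \<longlonglongrightarrow> 0 \<and>
    (\<forall>(M::int) (N::nat) (S::nat). N \<ge> 1 \<longrightarrow> S \<ge> 1 \<longrightarrow>
      real (Q_total (\<lambda>n. poly f (g ^ n)) M N S) \<le>
        (real S powr (3 / (3 + \<alpha>)) * real N powr ((3 - \<alpha>) / (3 + \<alpha>))
          + real S powr (1 / 2) * real N powr ((3 - \<alpha>) / (1 + 3 * \<alpha>)))
        * real N powr \<epsilon> N)"
proof -
  have \<alpha>1: "\<alpha> < 1" using shifted_primes by (rule shifted_primes_exponent_less_1)
  have "degree f \<ge> 2" using deg by simp
  from Q_count_exp_poly_le[OF g this lead roots] obtain K where K: "K \<ge> 1"
    "\<And>M N s. N \<ge> 1 \<Longrightarrow> real (Q_count (\<lambda>n. poly f (g ^ n)) M N s) \<le> K * (1 + ln (real N))"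
    by blast
  \<comment> \<open>Chosen so that \<open>N powr \<epsilon> N\<close> equals
    \<open>K * (1 + ln N)\<close> for \<open>N > 1\<close>; it tends to 0 like
    \<open>ln (ln N) / ln N\<close>.\<close>
  define \<epsilon> where "\<epsilon> N = ln (K * (1 + ln (real N))) / ln (real N)" for N :: nat
  have "\<epsilon> \<longlonglongrightarrow> 0"
    unfolding \<epsilon>_def using K(1) by real_asymp
  moreover have "real (Q_total (\<lambda>n. poly f (g ^ n)) M N S) \<le>
        (real S powr (3 / (3 + \<alpha>)) * real N powr ((3 - \<alpha>) / (3 + \<alpha>))
          + real S powr (1 / 2) * real N powr ((3 - \<alpha>) / (1 + 3 * \<alpha>)))
        * real N powr \<epsilon> N" if N: "N \<ge> 1" and S: "S \<ge> 1" for M :: int and N S :: nat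
  proof -
    define Q where "Q = real (Q_total (\<lambda>n. poly f (g ^ n)) M N S)"
    define T where "T = real N powr \<epsilon> N"
    have lnN: "ln (real N) \<ge> 0" using N by simp
    have QN: "Q \<le> real N" unfolding Q_def using Q_total_le_length by simp
    have T: "T \<ge> 1" "Q \<le> real S * T"
    proof -
      have "1 * 1 \<le> K * (1 + ln (real N))" using K(1) lnN by (intro mult_mono) auto
      hence K1: "K * (1 + ln (real N)) \<ge> 1" by simp
      have "T \<ge> 1 \<and> Q \<le> real S * T"
      proof (cases "N = 1")
        case True
        thus ?thesis using QN S by (simp add: T_def)
      next
        case False
        hence "ln (real N) > 0" using N by (intro ln_gt_zero) simp
        hence T_eq: "T = K * (1 + ln (real N))"
          unfolding T_def \<epsilon>_def powr_def using K1 N by simp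
        have "Q \<le> real S * T"
          unfolding Q_def T_eq using K(2)[OF N] K1 by (intro Q_total_le_mult) auto
        thus ?thesis using K1 T_eq by simp
      qed
      thus "T \<ge> 1" "Q \<le> real S * T" by auto
    qed
    have "real N * 1 \<le> real N * T" using T(1) by (intro mult_left_mono) auto
    hence "Q \<le> min (real S) (real N) * T" using T(2) QN by (auto simp: min_def)
    also have "\<dots> \<le> (real S powr (3 / (3 + \<alpha>)) * real N powr ((3 - \<alpha>) / (3 + \<alpha>))) * T"
    proof (intro mult_right_mono min_le_powr_mult_powr)
      \<comment> \<open>The sum is \<open>(6 - \<alpha>) / (3 + \<alpha>)\<close>, which is at least
        1 exactly when \<open>\<alpha> \<le> 3 / 2\<close>; this follows from
        \<open>\<alpha> < 1\<close>.\<close>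
      show "3 / (3 + \<alpha>) + (3 - \<alpha>) / (3 + \<alpha>) \<ge> 1"
        using \<alpha> \<alpha>1 by (simp add: add_divide_distrib[symmetric] le_divide_eq)
    qed (use N S \<alpha> \<alpha>1 T in auto)
    also have "\<dots> \<le> (real S powr (3 / (3 + \<alpha>)) * real N powr ((3 - \<alpha>) / (3 + \<alpha>))
          + real S powr (1 / 2) * real N powr ((3 - \<alpha>) / (1 + 3 * \<alpha>))) * T"
      using T(1) by (intro mult_right_mono) auto
    finally show ?thesis by (simp only: Q_def T_def)
  qed
  ultimately show ?thesis by blast
qed

end
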